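(* Let $n\ge 1$, let $b_1,\dots,b_{n-1}$ be elements of a commutative ring $R$, and let $\lambda$ be an indeterminate. For $0\le k\le n$ let $D_k = \det\left(M_{b_1 \dots b_{k-1}}^{\lambda \dots \lambda}\right) \in R[\lambda]$, where $M_{b_1 \dots b_{k-1}}^{\lambda \dots \lambda}$ is the $k\times k$ matrix with $(i,j)$ entry $b_i$ if $i<j$, $b_j$ if $j<i$, and $\lambda$ if $i=j$, and $D_0=1$. For $1\le m\le n-1$ define \[ B_m = \begin{pmatrix} 2(\lambda - b_m) & -(b_m-\lambda)^2 \\ 1 & 0 \end{pmatrix}. \] Then \[ \begin{pmatrix} D_n \\ D_{n-1} \end{pmatrix} = B_{n-1} B_{n-2} \cdots B_1 \begin{pmatrix} \lambda \\ 1 \end{pmatrix}. \]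
   Context: The empty product of matrices (case $n=1$) is the identity matrix. *)

theory Defs
  imports "Jordan_Normal_Form.Determinant" "HOL-Computational_Algebra.Polynomial"
begin

abbreviation indet :: "'a::comm_ring_1 poly" where
  "indet \<equiv> monom 1 1"

text \<open>
  Only the values \<open>b 1, \<dots>, b (k - 1)\<close> enter the \<open>k \<times> k\<close> matrix below.  Matrix indices of type
  \<^typ>\<open>'a mat\<close> start at 0 whereas the \<open>b\<close>'s are numbered from 1, hence the shift by one.
\<close>

definition M_mat :: "(nat \<Rightarrow> 'a::comm_ring_1) \<Rightarrow> nat \<Rightarrow> 'a poly mat" where
  "M_mat b k = mat k k (\<lambda>(i, j).
     if i < j then [:b (i + 1):] else if j < i then [:b (j + 1):] else indet)"

definition D_poly :: "(nat \<Rightarrow> 'a::comm_ring_1) \<Rightarrow> nat \<Rightarrow> 'a poly" where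
  "D_poly b k = det (M_mat b k)"

lemma D_poly_0: "D_poly b 0 = 1"
  by (simp add: D_poly_def M_mat_def)

definition B_mat :: "(nat \<Rightarrow> 'a::comm_ring_1) \<Rightarrow> nat \<Rightarrow> 'a poly mat" where
  "B_mat b m = mat_of_rows_list 2
     [[2 * (indet - [:b m:]), - ([:b m:] - indet)\<^sup>2],
      [1,                      0]]"

text \<open>The product \<open>Bs\<^sub>1 * (Bs\<^sub>2 * (\<dots> * 1))\<close> of a list of \<open>2 \<times> 2\<close> matrices, in list order.\<close>

definition mat2_prod_list :: "'a::comm_ring_1 mat list \<Rightarrow> 'a mat" where
  "mat2_prod_list Bs = foldr (*) Bs (1\<^sub>m 2)"

end

theory Submission imports Defs begin

text \<open>
  Subtracting the penultimate row of the \<open>(k + 2) \<times> (k + 2)\<close> matrix from the last one, and then doing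
  the same with the columns, leaves the \<open>(k + 1) \<times> (k + 1)\<close> matrix bordered by a row and a column
  whose only nonzero entries are the corner \<open>2 (\<lambda> - b)\<close> and, next to it, \<open>b - \<lambda>\<close>, where
  \<open>b = b\<^sub>k\<^sub>+\<^sub>1\<close>.  Expanding along this border gives a three-term recurrence for the determinants,
  of which \<open>B\<^sub>k\<^sub>+\<^sub>1\<close> is the companion matrix.
\<close>

text \<open>Expansion along the last row leaves two terms. The minor of the entry left of the corner
  has a last column that is zero above its bottom entry, so a second expansion applies; the minus
  sign is \<open>(- 1) ^ (Suc k + k)\<close>.\<close>

lemma det_bordered_last:
  fixes A :: "'a::comm_ring_1 mat"
  assumes A: "A \<in> carrier_mat (Suc (Suc k)) (Suc (Suc k))"
    and row: "\<And>j. j < k \<Longrightarrow> A $$ (Suc k, j) = 0"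
    and col: "\<And>i. i < k \<Longrightarrow> A $$ (i, Suc k) = 0"
  shows "det A = A $$ (Suc k, Suc k) * det (mat (Suc k) (Suc k) (($$) A)) -
    A $$ (Suc k, k) * A $$ (k, Suc k) * det (mat k k (($$) A))"
proof -
  let ?C = "mat_delete A (Suc k) k"
  have C: "?C \<in> carrier_mat (Suc k) (Suc k)"
    using A by (simp add: mat_delete_def)
  \<comment> \<open>Deleting column \<open>k\<close> shifts column \<open>Suc k\<close> of
    \<open>A\<close> into position \<open>k\<close>.\<close>
  have C_col: "?C $$ (i, k) = (if i = k then A $$ (k, Suc k) else 0)" if "i < Suc k" for i
    using that A col[of i] by (auto simp: mat_delete_def)
  have "mat_delete ?C k k = mat k k (($$) A)"
    using A by (intro eq_matI) (auto simp: mat_delete_def)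
  then have detC: "det ?C = A $$ (k, Suc k) * det (mat k k (($$) A))"
    by (subst laplace_expansion_column[OF C, of k]) (simp_all add: C_col cofactor_def)
  have "mat_delete A (Suc k) (Suc k) = mat (Suc k) (Suc k) (($$) A)"
    using A by (intro eq_matI) (auto simp: mat_delete_def)
  then show ?thesis
    by (subst laplace_expansion_row[OF A, of "Suc k"])
      (simp_all add: row cofactor_def detC mult.assoc)
qed

lemma D_poly_Suc_Suc:
  "D_poly b (Suc (Suc k)) = 2 * (indet - [:b (Suc k):]) * D_poly b (Suc k) -
    ([:b (Suc k):] - indet)\<^sup>2 * D_poly b k"
proof -
  let ?M = "M_mat b (Suc (Suc k))"
  let ?A = "addcol (- 1) (Suc k) k (addrow (- 1) (Suc k) k ?M)"
  have A: "?A \<in> carrier_mat (Suc (Suc k)) (Suc (Suc k))"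
    by (rule carrier_matI) (simp_all add: M_mat_def)
  have det: "det ?A = D_poly b (Suc (Suc k))"
    unfolding D_poly_def
    by (subst det_addcol[of _ "Suc (Suc k)"], simp_all add: carrier_matI M_mat_def)
      (rule det_addrow[of _ "Suc (Suc k)"], simp_all)
  \<comment> \<open>Off the diagonal an entry depends only on the smaller index, so rows
    \<open>k\<close> and \<open>Suc k\<close> of \<open>?M\<close> agree left of column
    \<open>k\<close>; likewise the columns.\<close>
  have row: "?A $$ (Suc k, j) = 0" if "j < k" for j
    using that by (simp add: M_mat_def)
  have col: "?A $$ (i, Suc k) = 0" if "i < k" for i
    using that by (simp add: M_mat_def)
  have corner: "?A $$ (Suc k, Suc k) = 2 * (indet - [:b (Suc k):])"
    "?A $$ (Suc k, k) = [:b (Suc k):] - indet" "?A $$ (k, Suc k) = [:b (Suc k):] - indet"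
    by (simp_all add: M_mat_def numeral_poly smult_diff_right)
  \<comment> \<open>The operations change only the last row and column, and the entries of
    \<open>M_mat\<close> do not depend on its size.\<close>
  have blocks: "mat (Suc k) (Suc k) (($$) ?A) = M_mat b (Suc k)"
    "mat k k (($$) ?A) = M_mat b k"
    by (rule eq_matI; auto simp: M_mat_def)+
  have "D_poly b (Suc (Suc k)) = det ?A"
    by (rule det[symmetric])
  also have "\<dots> = ?A $$ (Suc k, Suc k) * det (mat (Suc k) (Suc k) (($$) ?A)) -
      ?A $$ (Suc k, k) * ?A $$ (k, Suc k) * det (mat k k (($$) ?A))"
    by (rule det_bordered_last[OF A row col])
  also have "\<dots> = 2 * (indet - [:b (Suc k):]) * D_poly b (Suc k) -
      ([:b (Suc k):] - indet)\<^sup>2 * D_poly b k"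
    unfolding corner blocks by (simp add: D_poly_def power2_eq_square)
  finally show ?thesis .
qed

lemma D_poly_1: "D_poly b (Suc 0) = indet"
  by (simp add: D_poly_def M_mat_def det_single)

lemma B_mat_carrier: "B_mat b m \<in> carrier_mat 2 2"
  by (simp add: B_mat_def mat_of_rows_list_def numeral_2_eq_2)

lemma B_mat_mult_vec:
  "B_mat b m *\<^sub>v vec_of_list [x, y] =
    vec_of_list [2 * (indet - [:b m:]) * x - ([:b m:] - indet)\<^sup>2 * y, x]"
  by (rule eq_vecI)
    (auto simp: B_mat_def mat_of_rows_list_def scalar_prod_def less_2_cases_iff numeral_2_eq_2
      less_Suc_eq vec_of_list_index)

lemma mat2_prod_list_carrier:
  "(\<And>B. B \<in> set Bs \<Longrightarrow> B \<in> carrier_mat 2 2) \<Longrightarrow> mat2_prod_list Bs \<in> carrier_mat 2 2"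
  by (induction Bs) (auto simp: mat2_prod_list_def intro!: mult_carrier_mat)

lemma mat2_prod_list_Cons: "mat2_prod_list (B # Bs) = B * mat2_prod_list Bs"
  by (simp add: mat2_prod_list_def)

theorem theorem2:
  fixes b :: "nat \<Rightarrow> 'a::comm_ring_1" and n :: nat
  assumes "n \<ge> 1"
  shows "vec_of_list [D_poly b n, D_poly b (n - 1)] =
    mat2_prod_list (map (B_mat b) (rev [1..<n])) *\<^sub>v vec_of_list [indet, 1]"
  using assms
proof (induction n rule: dec_induct)
  case base
  have "vec_of_list [indet, 1 :: 'a poly] \<in> carrier_vec 2"
    by (simp add: carrier_vecI)
  then show ?case
    by (simp add: D_poly_0 D_poly_1 mat2_prod_list_def del: vec_of_list_Cons)
next
  case (step n)
  let ?P = "mat2_prod_list (map (B_mat b) (rev [1..<n]))"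
  let ?v = "vec_of_list [indet, 1 :: 'a poly]"
  \<comment> \<open>The recurrence starts at index 2; here \<open>n - 1\<close> becomes
    \<open>k\<close>.\<close>
  obtain k where n: "n = Suc k"
    using step.hyps by (cases n) auto
  \<comment> \<open>As \<open>1 \<le> n\<close>, the reversed list gains \<open>n\<close> at its
    head, so the new factor enters on the left.\<close>
  have "mat2_prod_list (map (B_mat b) (rev [1..<Suc n])) *\<^sub>v ?v = (B_mat b n * ?P) *\<^sub>v ?v"
    using step.hyps by (simp add: mat2_prod_list_Cons del: vec_of_list_Cons)
  also have "\<dots> = B_mat b n *\<^sub>v (?P *\<^sub>v ?v)"
    by (rule assoc_mult_mat_vec[of _ 2 2 _ 2])
      (auto intro!: mat2_prod_list_carrier B_mat_carrier carrier_vecI)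
  also have "?P *\<^sub>v ?v = vec_of_list [D_poly b n, D_poly b (n - 1)]"
    by (rule step.IH[symmetric])
  also have "B_mat b n *\<^sub>v \<dots> = vec_of_list [D_poly b (Suc n), D_poly b (Suc n - 1)]"
    by (simp add: B_mat_mult_vec n D_poly_Suc_Suc del: vec_of_list_Cons)
  finally show ?case
    by (rule sym)
qed

end
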